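(* Let $k$ be a field and let $\mathcal{C}$ be a QG-category. Then $R=R(\mathcal{C})$ is noetherian.
   Context: $\mathbf{FI}$ is the category of finite sets and injections. A functor is conservative if it reflects isomorphisms. An $\mathbf{FI}$-concrete category is a category $\mathcal{C}$ equipped with a faithful conservative functor $|\cdot|\colon\mathcal{C}\to\mathbf{FI}$. A concrete functor $\Phi\colon\mathcal{C}\to\mathcal{D}$ between such categories is a functor equipped with a natural isomorphism $|A|\to|\Phi(A)|$. For an $\mathbf{FI}$-concrete category $\mathcal{C}$ and object $A$, $R_A=k[x_i]_{i\in|A|}$; a morphism $\phi\colon A\to B$ induces a $k$-algebra homomorphism $\phi_*\colon R_A\to R_B$, $\phi_*(x_i)=x_{\phi(i)}$ (where $\phi(i)$ means $|\phi|(i)$). This defines a functor $R=R(\mathcal{C})$ from $\mathcal{C}$ to $k$-algebras. An ideal system in $R$ is a rule assigning to each object $A$ an ideal $I_A$ of $R_A$ such that $\phi_*(I_A)\subset I_B$ for every morphism $\phi\colon A\to B$. Write $I\subset J$ if $I_A\subset J_A$ for all $A$. $R$ is noetherian if ideal systems of $R$ satisfy the ascending chain condition. A weighting on $A$ is a function $\alpha\colon|A|\to\mathbf{N}$ (with $0\in\mathbf{N}$). A weighted object is a pair $(A,\alpha)$; a morphism $(A,\alpha)\to(B,\beta)$ is a morphism $\phi\colon A\to B$ in $\mathcal{C}$ with $\alpha(x)\le\beta(\phi(x))$ for all $x\in|A|$. $\mathcal{M}(\mathcal{C})$ is the set of isomorphism classes $[A,\alpha]$ of weighted objects, partially ordered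 by $[A,\alpha]\le[B,\beta]$ if there is a morphism $(A,\alpha)\to(B,\beta)$. An ordering on $\mathcal{C}$ is a rule assigning to each object $A$ a total order on $|A|$ such that $|\phi|$ is order-preserving for every morphism $\phi$; $\mathcal{C}$ is orderable if it admits an ordering. wqo means well-quasi-order (every infinite sequence $x_1,x_2,\dots$ has $i<j$ with $x_i\le x_j$). A G-category is an $\mathbf{FI}$-concrete category $\mathcal{C}$ that is orderable and for which $\mathcal{M}(\mathcal{C})$ is wqo. A QG-category is an $\mathbf{FI}$-concrete category $\mathcal{C}$ for which there exists a G-category $\mathcal{D}$ and a concrete functor $\mathcal{D}\to\mathcal{C}$ that is essentially surjective. *)

theory Defs
  imports "HOL-Algebra.Ideal" "HOL-Library.Poly_Mapping"
begin

section \<open>Categories and functors\<close>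

record ('o, 'm) cat =
  Obj :: "'o set"
  Arr :: "'m set"
  Dom :: "'m \<Rightarrow> 'o"
  Cod :: "'m \<Rightarrow> 'o"
  Ident :: "'o \<Rightarrow> 'm"
  Comp :: "'m \<Rightarrow> 'm \<Rightarrow> 'm"  \<comment> \<open>\<open>Comp C g f\<close> is \<open>g\<close> after \<open>f\<close>\<close>

definition homset :: "('o, 'm, 'z) cat_scheme \<Rightarrow> 'o \<Rightarrow> 'o \<Rightarrow> 'm set" where
  "homset C A B = {f \<in> Arr C. Dom C f = A \<and> Cod C f = B}"

locale category =
  fixes C :: "('o, 'm, 'z) cat_scheme"
  assumes dom_obj: "f \<in> Arr C \<Longrightarrow> Dom C f \<in> Obj C"
    and cod_obj: "f \<in> Arr C \<Longrightarrow> Cod C f \<in> Obj C"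
    and ident_hom: "A \<in> Obj C \<Longrightarrow> Ident C A \<in> homset C A A"
    and comp_hom: "\<lbrakk>f \<in> homset C A B; g \<in> homset C B D\<rbrakk> \<Longrightarrow> Comp C g f \<in> homset C A D"
    and comp_ident: "f \<in> homset C A B \<Longrightarrow> Comp C f (Ident C A) = f"
    and ident_comp: "f \<in> homset C A B \<Longrightarrow> Comp C (Ident C B) f = f"
    and comp_assoc: "\<lbrakk>f \<in> homset C A B; g \<in> homset C B D; h \<in> homset C D E\<rbrakk>
      \<Longrightarrow> Comp C h (Comp C g f) = Comp C (Comp C h g) f"

definition isomorphism :: "('o, 'm, 'z) cat_scheme \<Rightarrow> 'm \<Rightarrow> bool" where
  "isomorphism C f \<longleftrightarrow> f \<in> Arr C \<and>
     (\<exists>g \<in> homset C (Cod C f) (Dom C f).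
        Comp C g f = Ident C (Dom C f) \<and> Comp C f g = Ident C (Cod C f))"

definition isomorphic_rel :: "('o, 'm, 'z) cat_scheme \<Rightarrow> 'o rel" where
  "isomorphic_rel C = {(A, B). A \<in> Obj C \<and> B \<in> Obj C \<and> (\<exists>f \<in> homset C A B. isomorphism C f)}"

record ('o, 'm, 'p, 'n) cfun =
  FObj :: "'o \<Rightarrow> 'p"
  FArr :: "'m \<Rightarrow> 'n"

locale cat_functor = dom: category C + cod: category D
  for C :: "('o, 'm, 'z) cat_scheme" and D :: "('p, 'n, 'y) cat_scheme" +
  fixes F :: "('o, 'm, 'p, 'n) cfun"
  assumes obj_map: "A \<in> Obj C \<Longrightarrow> FObj F A \<in> Obj D"
    and arr_map: "f \<in> homset C A B \<Longrightarrow> FArr F f \<in> homset D (FObj F A) (FObj F B)"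
    and ident_map: "A \<in> Obj C \<Longrightarrow> FArr F (Ident C A) = Ident D (FObj F A)"
    and comp_map: "\<lbrakk>f \<in> homset C A B; g \<in> homset C B E\<rbrakk>
      \<Longrightarrow> FArr F (Comp C g f) = Comp D (FArr F g) (FArr F f)"

definition functor_comp ::
    "('p, 'n, 'q, 'l) cfun \<Rightarrow> ('o, 'm, 'p, 'n) cfun \<Rightarrow> ('o, 'm, 'q, 'l) cfun" where
  "functor_comp G F = \<lparr>FObj = FObj G \<circ> FObj F, FArr = FArr G \<circ> FArr F\<rparr>"

definition faithful :: "('o, 'm, 'z) cat_scheme \<Rightarrow> ('o, 'm, 'p, 'n) cfun \<Rightarrow> bool" where
  "faithful C F \<longleftrightarrow> (\<forall>A \<in> Obj C. \<forall>B \<in> Obj C. inj_on (FArr F) (homset C A B))"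

definition conservative ::
    "('o, 'm, 'z) cat_scheme \<Rightarrow> ('p, 'n, 'y) cat_scheme \<Rightarrow> ('o, 'm, 'p, 'n) cfun \<Rightarrow> bool" where
  "conservative C D F \<longleftrightarrow> (\<forall>f \<in> Arr C. isomorphism D (FArr F f) \<longrightarrow> isomorphism C f)"

definition essentially_surjective ::
    "('o, 'm, 'z) cat_scheme \<Rightarrow> ('p, 'n, 'y) cat_scheme \<Rightarrow> ('o, 'm, 'p, 'n) cfun \<Rightarrow> bool" where
  "essentially_surjective C D F \<longleftrightarrow>
     (\<forall>B \<in> Obj D. \<exists>A \<in> Obj C. (FObj F A, B) \<in> isomorphic_rel D)"

definition natural_isomorphism ::
    "('o, 'm, 'z) cat_scheme \<Rightarrow> ('p, 'n, 'y) cat_scheme \<Rightarrow> ('o, 'm, 'p, 'n) cfun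
      \<Rightarrow> ('o, 'm, 'p, 'n) cfun \<Rightarrow> ('o \<Rightarrow> 'n) \<Rightarrow> bool" where
  "natural_isomorphism C D F G \<eta> \<longleftrightarrow>
     (\<forall>A \<in> Obj C. \<eta> A \<in> homset D (FObj F A) (FObj G A) \<and> isomorphism D (\<eta> A)) \<and>
     (\<forall>A \<in> Obj C. \<forall>B \<in> Obj C. \<forall>f \<in> homset C A B.
        Comp D (\<eta> B) (FArr F f) = Comp D (FArr G f) (\<eta> A))"


section \<open>FI-concrete categories\<close>

text \<open>The elements of the finite sets are drawn from an arbitrary type \<open>'e\<close>.  An arrow of FI is a
  triple of source, underlying function and target; functions are extensional, so that
  equality of arrows is equality of functions on the source.\<close>

type_synonym 'e fi_arrow = "'e set \<times> ('e \<Rightarrow> 'e) \<times> 'e set"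

definition FI :: "('e set, 'e fi_arrow) cat" where
  "FI = \<lparr>Obj = {S. finite S},
         Arr = {(S, f, T). finite S \<and> finite T \<and> f \<in> S \<rightarrow>\<^sub>E T \<and> inj_on f S},
         Dom = (\<lambda>(S, f, T). S),
         Cod = (\<lambda>(S, f, T). T),
         Ident = (\<lambda>S. (S, \<lambda>x\<in>S. x, S)),
         Comp = (\<lambda>(T, g, U) (S, f, T'). (S, compose S g f, U))\<rparr>"

record ('o, 'm, 'e) fi_cat = "('o, 'm) cat" +
  forget :: "('o, 'm, 'e set, 'e fi_arrow) cfun"

definition fi_concrete :: "('o, 'm, 'e) fi_cat \<Rightarrow> bool" where
  "fi_concrete C \<longleftrightarrow>
     cat_functor C FI (forget C) \<and> faithful C (forget C) \<and> conservative C FI (forget C)"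

abbreviation pts :: "('o, 'm, 'e) fi_cat \<Rightarrow> 'o \<Rightarrow> 'e set" where
  "pts C A \<equiv> FObj (forget C) A"

abbreviation fn :: "('o, 'm, 'e) fi_cat \<Rightarrow> 'm \<Rightarrow> 'e \<Rightarrow> 'e" where
  "fn C \<phi> \<equiv> fst (snd (FArr (forget C) \<phi>))"

definition concrete_functor ::
    "('o, 'm, 'e) fi_cat \<Rightarrow> ('p, 'n, 'e) fi_cat \<Rightarrow> ('o, 'm, 'p, 'n) cfun
      \<Rightarrow> ('o \<Rightarrow> 'e fi_arrow) \<Rightarrow> bool" where
  "concrete_functor C D \<Phi> \<eta> \<longleftrightarrow>
     cat_functor C D \<Phi> \<and>
     natural_isomorphism C FI (forget C) (functor_comp (forget D) \<Phi>) \<eta>"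


section \<open>Weighted objects, orderings, G- and QG-categories\<close>

text \<open>Weightings are extensional functions, so that a weighting is determined by its values on the
  underlying set.  Arrows again carry source and target, because the same arrow of the
  underlying category may be compatible with several pairs of weightings.\<close>

definition weighted_cat ::
    "('o, 'm, 'e) fi_cat
      \<Rightarrow> ('o \<times> ('e \<Rightarrow> nat), ('o \<times> ('e \<Rightarrow> nat)) \<times> 'm \<times> ('o \<times> ('e \<Rightarrow> nat))) cat" where
  "weighted_cat C =
     (let W = (SIGMA A : Obj C. pts C A \<rightarrow>\<^sub>E UNIV) in
     \<lparr>Obj = W,
      Arr = {((A, \<alpha>), \<phi>, (B, \<beta>)). (A, \<alpha>) \<in> W \<and> (B, \<beta>) \<in> W \<and> \<phi> \<in> homset C A B \<and>
               (\<forall>x \<in> pts C A. \<alpha> x \<le> \<beta> (fn C \<phi> x))},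
      Dom = (\<lambda>(X, \<phi>, Y). X),
      Cod = (\<lambda>(X, \<phi>, Y). Y),
      Ident = (\<lambda>(A, \<alpha>). ((A, \<alpha>), Ident C A, (A, \<alpha>))),
      Comp = (\<lambda>(Y, \<psi>, Z) (X, \<phi>, Y'). (X, Comp C \<psi> \<phi>, Z))\<rparr>)"

definition weighted_classes :: "('o, 'm, 'e) fi_cat \<Rightarrow> ('o \<times> ('e \<Rightarrow> nat)) set set" where
  "weighted_classes C = Obj (weighted_cat C) // isomorphic_rel (weighted_cat C)"

definition weighted_le ::
    "('o, 'm, 'e) fi_cat \<Rightarrow> ('o \<times> ('e \<Rightarrow> nat)) set \<Rightarrow> ('o \<times> ('e \<Rightarrow> nat)) set \<Rightarrow> bool" where
  "weighted_le C X Y \<longleftrightarrow> (\<exists>a \<in> X. \<exists>b \<in> Y. homset (weighted_cat C) a b \<noteq> {})"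

definition wqo_on :: "'a set \<Rightarrow> ('a \<Rightarrow> 'a \<Rightarrow> bool) \<Rightarrow> bool" where
  "wqo_on A leq \<longleftrightarrow> reflp_on A leq \<and> transp_on A leq \<and>
     (\<forall>x :: nat \<Rightarrow> 'a. range x \<subseteq> A \<longrightarrow> (\<exists>i j. i < j \<and> leq (x i) (x j)))"

definition ordering_on :: "('o, 'm, 'e) fi_cat \<Rightarrow> ('o \<Rightarrow> 'e rel) \<Rightarrow> bool" where
  "ordering_on C r \<longleftrightarrow>
     (\<forall>A \<in> Obj C. linear_order_on (pts C A) (r A)) \<and>
     (\<forall>A \<in> Obj C. \<forall>B \<in> Obj C. \<forall>\<phi> \<in> homset C A B. \<forall>(x, y) \<in> r A. (fn C \<phi> x, fn C \<phi> y) \<in> r B)"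

definition orderable :: "('o, 'm, 'e) fi_cat \<Rightarrow> bool" where
  "orderable C \<longleftrightarrow> (\<exists>r. ordering_on C r)"

definition G_category :: "('o, 'm, 'e) fi_cat \<Rightarrow> bool" where
  "G_category C \<longleftrightarrow>
     fi_concrete C \<and> orderable C \<and> wqo_on (weighted_classes C) (weighted_le C)"

text \<open>HOL cannot quantify existentially over types, so the types \<open>'p\<close> and \<open>'n\<close> of objects and
  arrows of the covering G-category are parameters.  A statement that assumes this predicate
  for arbitrary \<open>'p\<close> and \<open>'n\<close> covers all possible G-categories.  Using the element type of \<open>C\<close>
  for \<open>D\<close> loses nothing: the forgetful functor of \<open>D\<close> can be replaced by the isomorphic functor
  that sends \<open>A\<close> to the underlying set of \<open>\<Phi> A\<close>.\<close>

definition QG_category :: "'p itself \<Rightarrow> 'n itself \<Rightarrow> ('o, 'm, 'e) fi_cat \<Rightarrow> bool" where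
  "QG_category _ _ C \<longleftrightarrow>
     fi_concrete C \<and>
     (\<exists>(D :: ('p, 'n, 'e) fi_cat) \<Phi> \<eta>.
        G_category D \<and> concrete_functor D C \<Phi> \<eta> \<and> essentially_surjective D C \<Phi>)"


section \<open>Polynomial rings and ideal systems\<close>

text \<open>Monomials are finitely supported exponent functions; a polynomial maps monomials to
  coefficients.  The ring \<open>poly_ring S\<close> consists of those polynomials that only
  involve variables indexed by \<open>S\<close>.\<close>

type_synonym ('e, 'k) mpoly = "('e \<Rightarrow>\<^sub>0 nat) \<Rightarrow>\<^sub>0 'k"

definition poly_ring :: "'e set \<Rightarrow> ('e, 'k::comm_ring_1) mpoly ring" where
  "poly_ring S =
     \<lparr>carrier = {p. \<forall>m \<in> Poly_Mapping.keys p. Poly_Mapping.keys m \<subseteq> S},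
      mult = (*), one = 1, zero = 0, add = (+)\<rparr>"

definition pvar :: "'e \<Rightarrow> ('e, 'k::comm_ring_1) mpoly" where
  "pvar i = Poly_Mapping.single (Poly_Mapping.single i 1) 1"

definition pconst :: "'k \<Rightarrow> ('e, 'k::comm_ring_1) mpoly" where
  "pconst c = Poly_Mapping.single 0 c"

text \<open>The algebra homomorphism that substitutes the variable with index \<open>f i\<close> for the variable with
  index \<open>i\<close>.\<close>

definition pushforward :: "('e \<Rightarrow> 'f) \<Rightarrow> ('e, 'k::comm_ring_1) mpoly \<Rightarrow> ('f, 'k) mpoly" where
  "pushforward f p =
     (\<Sum>m \<in> Poly_Mapping.keys p. pconst (Poly_Mapping.lookup p m) *
        (\<Prod>i \<in> Poly_Mapping.keys m. pvar (f i) ^ Poly_Mapping.lookup m i))"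

definition R_obj :: "('o, 'm, 'e) fi_cat \<Rightarrow> 'o \<Rightarrow> ('e, 'k::comm_ring_1) mpoly ring" where
  "R_obj C A = poly_ring (pts C A)"

definition R_arr :: "('o, 'm, 'e) fi_cat \<Rightarrow> 'm \<Rightarrow> ('e, 'k::comm_ring_1) mpoly \<Rightarrow> ('e, 'k) mpoly" where
  "R_arr C \<phi> = pushforward (fn C \<phi>)"

definition ideal_system :: "('o, 'm, 'e) fi_cat \<Rightarrow> ('o \<Rightarrow> ('e, 'k::comm_ring_1) mpoly set) \<Rightarrow> bool" where
  "ideal_system C I \<longleftrightarrow>
     (\<forall>A \<in> Obj C. ideal (I A) (R_obj C A)) \<and>
     (\<forall>A \<in> Obj C. \<forall>B \<in> Obj C. \<forall>\<phi> \<in> homset C A B. R_arr C \<phi> ` I A \<subseteq> I B)"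

text \<open>Ideal systems are only compared on objects of \<open>C\<close>; their values elsewhere are irrelevant.\<close>

definition R_noetherian :: "'k::comm_ring_1 itself \<Rightarrow> ('o, 'm, 'e) fi_cat \<Rightarrow> bool" where
  "R_noetherian _ C \<longleftrightarrow>
     (\<forall>J :: nat \<Rightarrow> 'o \<Rightarrow> ('e, 'k) mpoly set.
        (\<forall>n. ideal_system C (J n)) \<and> (\<forall>n. \<forall>A \<in> Obj C. J n A \<subseteq> J (Suc n) A)
        \<longrightarrow> (\<exists>N. \<forall>n \<ge> N. \<forall>A \<in> Obj C. J n A = J N A))"


section \<open>Consistency of the definitions\<close>

lemma category_FI: "category (FI :: ('e set, 'e fi_arrow) cat)"
proof
  fix f :: "'e fi_arrow"
  assume "f \<in> Arr FI"
  then show "Dom FI f \<in> Obj FI" "Cod FI f \<in> Obj FI" by (auto simp: FI_def)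
next
  fix A :: "'e set" assume "A \<in> Obj FI"
  then show "Ident FI A \<in> homset FI A A" by (auto simp: FI_def homset_def)
next
  fix f g :: "'e fi_arrow" and A B D
  assume "f \<in> homset FI A B" "g \<in> homset FI B D"
  then show "Comp FI g f \<in> homset FI A D"
    by (auto simp: FI_def homset_def compose_def inj_on_def Pi_iff PiE_iff)
next
  fix f :: "'e fi_arrow" and A B
  assume "f \<in> homset FI A B"
  then show "Comp FI f (Ident FI A) = f" "Comp FI (Ident FI B) f = f"
    by (auto simp: FI_def homset_def compose_def PiE_iff extensional_def fun_eq_iff) metis
next
  fix f g h :: "'e fi_arrow" and A B D E
  assume "f \<in> homset FI A B" "g \<in> homset FI B D" "h \<in> homset FI D E"
  then show "Comp FI h (Comp FI g f) = Comp FI (Comp FI h g) f"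
    by (auto simp: FI_def homset_def compose_def PiE_iff extensional_def fun_eq_iff)
qed

lemma fi_concreteD:
  assumes "fi_concrete C"
  shows "category C"
    and "A \<in> Obj C \<Longrightarrow> finite (pts C A)"
    and "\<phi> \<in> homset C A B \<Longrightarrow> fn C \<phi> \<in> pts C A \<rightarrow>\<^sub>E pts C B \<and> inj_on (fn C \<phi>) (pts C A)"
    and "A \<in> Obj C \<Longrightarrow> fn C (Ident C A) = (\<lambda>x \<in> pts C A. x)"
    and "\<lbrakk>\<phi> \<in> homset C A B; \<psi> \<in> homset C B D\<rbrakk>
      \<Longrightarrow> fn C (Comp C \<psi> \<phi>) = compose (pts C A) (fn C \<psi>) (fn C \<phi>)"
proof -
  interpret cat_functor C FI "forget C" using assms by (simp add: fi_concrete_def)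
  show "category C" ..
  show "finite (pts C A)" if "A \<in> Obj C" using obj_map[OF that] by (simp add: FI_def)
  show "fn C \<phi> \<in> pts C A \<rightarrow>\<^sub>E pts C B \<and> inj_on (fn C \<phi>) (pts C A)" if "\<phi> \<in> homset C A B"
    using arr_map[OF that] by (auto simp: FI_def homset_def)
  show "fn C (Ident C A) = (\<lambda>x \<in> pts C A. x)" if "A \<in> Obj C"
    using ident_map[OF that] by (simp add: FI_def)
  show "fn C (Comp C \<psi> \<phi>) = compose (pts C A) (fn C \<psi>) (fn C \<phi>)"
    if "\<phi> \<in> homset C A B" "\<psi> \<in> homset C B D"
    using comp_map[OF that] arr_map[OF that(1)] arr_map[OF that(2)]
    by (auto simp: FI_def homset_def split: prod.splits)
qed

lemma homset_weighted:
  "homset (weighted_cat C) (A, \<alpha>) (B, \<beta>) =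
     {((A, \<alpha>), \<phi>, (B, \<beta>)) | \<phi>. A \<in> Obj C \<and> B \<in> Obj C \<and> \<alpha> \<in> pts C A \<rightarrow>\<^sub>E UNIV \<and> \<beta> \<in> pts C B \<rightarrow>\<^sub>E UNIV \<and>
        \<phi> \<in> homset C A B \<and> (\<forall>x \<in> pts C A. \<alpha> x \<le> \<beta> (fn C \<phi> x))}"
  by (auto simp: homset_def weighted_cat_def Let_def)

lemma weighted_homE:
  assumes "f \<in> homset (weighted_cat C) X Y"
  obtains \<phi> where "f = (X, \<phi>, Y)" "\<phi> \<in> homset C (fst X) (fst Y)"
  using assms by (cases X; cases Y) (auto simp: homset_weighted)

lemma weighted_Comp: "Comp (weighted_cat C) (Y, \<psi>, Z) (X, \<phi>, Y') = (X, Comp C \<psi> \<phi>, Z)"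
  by (simp add: weighted_cat_def Let_def)

lemma weighted_Ident: "Ident (weighted_cat C) X = (X, Ident C (fst X), X)"
  by (cases X) (simp add: weighted_cat_def Let_def)

lemma category_weighted:
  assumes "fi_concrete C"
  shows "category (weighted_cat C)"
proof -
  interpret C: category C by (rule fi_concreteD(1)[OF assms])
  let ?W = "weighted_cat C"
  show ?thesis
  proof
    fix f assume "f \<in> Arr ?W"
    then show "Dom ?W f \<in> Obj ?W" "Cod ?W f \<in> Obj ?W" by (auto simp: weighted_cat_def Let_def)
  next
    fix X assume X: "X \<in> Obj ?W"
    obtain A \<alpha> where X_eq: "X = (A, \<alpha>)" by fastforce
    have "A \<in> Obj C" "\<alpha> \<in> pts C A \<rightarrow>\<^sub>E UNIV"
      using X by (auto simp: X_eq weighted_cat_def Let_def)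
    then show "Ident ?W X \<in> homset ?W X X"
      by (simp add: X_eq weighted_Ident homset_weighted C.ident_hom fi_concreteD(4)[OF assms])
  next
    fix f g X Y Z assume fg: "f \<in> homset ?W X Y" "g \<in> homset ?W Y Z"
    obtain A \<alpha> B \<beta> D \<delta> where XYZ: "X = (A, \<alpha>)" "Y = (B, \<beta>)" "Z = (D, \<delta>)"
      by (metis surj_pair)
    obtain \<phi> \<psi> where fg_eq: "f = (X, \<phi>, Y)" "g = (Y, \<psi>, Z)"
      and hom: "\<phi> \<in> homset C A B" "\<psi> \<in> homset C B D"
      and wle: "\<forall>x \<in> pts C A. \<alpha> x \<le> \<beta> (fn C \<phi> x)" "\<forall>x \<in> pts C B. \<beta> x \<le> \<delta> (fn C \<psi> x)"
      using fg unfolding XYZ homset_weighted by blast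
    have "\<alpha> x \<le> \<delta> (fn C (Comp C \<psi> \<phi>) x)" if x: "x \<in> pts C A" for x
    proof -
      have "fn C \<phi> x \<in> pts C B" using fi_concreteD(3)[OF assms hom(1)] x by blast
      then have "\<alpha> x \<le> \<delta> (fn C \<psi> (fn C \<phi> x))" using wle x order_trans by blast
      then show ?thesis using fi_concreteD(5)[OF assms hom] x by (simp add: compose_def)
    qed
    then have "(X, Comp C \<psi> \<phi>, Z) \<in> homset ?W X Z"
      using fg C.comp_hom[OF hom] unfolding XYZ homset_weighted by blast
    then show "Comp ?W g f \<in> homset ?W X Z"
      by (simp add: fg_eq weighted_Comp)
  next
    fix f X Y assume "f \<in> homset ?W X Y"
    then show "Comp ?W f (Ident ?W X) = f" "Comp ?W (Ident ?W Y) f = f"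
      by (auto elim!: weighted_homE simp: weighted_Comp weighted_Ident C.comp_ident C.ident_comp)
  next
    fix f g h X Y Z V
    assume "f \<in> homset ?W X Y" "g \<in> homset ?W Y Z" "h \<in> homset ?W Z V"
    then show "Comp ?W h (Comp ?W g f) = Comp ?W (Comp ?W h g) f"
      by (auto elim!: weighted_homE simp: weighted_Comp C.comp_assoc)
  qed
qed

lemma (in category) equiv_isomorphic_rel: "equiv (Obj C) (isomorphic_rel C)"
proof (rule equivI)
  show "isomorphic_rel C \<subseteq> Obj C \<times> Obj C" by (auto simp: isomorphic_rel_def)
  show "refl_on (Obj C) (isomorphic_rel C)"
  proof (rule refl_onI)
    fix A assume A: "A \<in> Obj C"
    have i: "Ident C A \<in> homset C A A" by (rule ident_hom[OF A])
    then have "isomorphism C (Ident C A)"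
      using comp_ident[OF i] by (auto simp: isomorphism_def homset_def)
    then show "(A, A) \<in> isomorphic_rel C" using A i by (auto simp: isomorphic_rel_def)
  qed
  show "sym (isomorphic_rel C)"
    unfolding sym_def isomorphic_rel_def isomorphism_def homset_def by fastforce
  show "trans (isomorphic_rel C)"
  proof (rule transI)
    fix A B D assume "(A, B) \<in> isomorphic_rel C" "(B, D) \<in> isomorphic_rel C"
    then obtain f f' g g' where obj: "A \<in> Obj C" "B \<in> Obj C" "D \<in> Obj C"
      and f: "f \<in> homset C A B" and f': "f' \<in> homset C B A"
      and g: "g \<in> homset C B D" and g': "g' \<in> homset C D B"
      and inv: "Comp C f' f = Ident C A" "Comp C f f' = Ident C B"
        "Comp C g' g = Ident C B" "Comp C g g' = Ident C D"
      unfolding isomorphic_rel_def isomorphism_def homset_def by auto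
    let ?h = "Comp C g f" and ?h' = "Comp C f' g'"
    have h: "?h \<in> homset C A D" and h': "?h' \<in> homset C D A"
      using comp_hom[OF f g] comp_hom[OF g' f'] .
    have "Comp C ?h' ?h = Comp C f' (Comp C g' (Comp C g f))"
      using comp_assoc[OF h g' f'] by simp
    also have "\<dots> = Ident C A"
      using comp_assoc[OF f g g'] ident_comp[OF f] inv by simp
    finally have 1: "Comp C ?h' ?h = Ident C A" .
    have "Comp C ?h ?h' = Comp C g (Comp C f (Comp C f' g'))"
      using comp_assoc[OF h' f g] by simp
    also have "\<dots> = Ident C D"
      using comp_assoc[OF g' f' f] ident_comp[OF g'] inv by simp
    finally have "isomorphism C ?h"
      using 1 h h' by (auto simp: isomorphism_def homset_def)
    then show "(A, D) \<in> isomorphic_rel C" using obj h by (auto simp: isomorphic_rel_def)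
  qed
qed

lemma weighted_le_preorder:
  assumes "fi_concrete C"
  shows "reflp_on (weighted_classes C) (weighted_le C)"
    and "transp_on (weighted_classes C) (weighted_le C)"
proof -
  interpret W: category "weighted_cat C" by (rule category_weighted[OF assms])
  note eq = W.equiv_isomorphic_rel
  show "reflp_on (weighted_classes C) (weighted_le C)"
  proof (rule reflp_onI)
    fix X assume X: "X \<in> weighted_classes C"
    then obtain a where "a \<in> X" "a \<in> Obj (weighted_cat C)"
      unfolding weighted_classes_def using eq
      by (metis equiv_class_self quotientE)
    then show "weighted_le C X X" using W.ident_hom unfolding weighted_le_def by blast
  qed
  show "transp_on (weighted_classes C) (weighted_le C)"
  proof (rule transp_onI)
    fix X Y Z assume Y: "Y \<in> weighted_classes C" and "weighted_le C X Y" "weighted_le C Y Z"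
    then obtain a b b' d f g where *: "a \<in> X" "b \<in> Y" "b' \<in> Y" "d \<in> Z"
      "f \<in> homset (weighted_cat C) a b" "g \<in> homset (weighted_cat C) b' d"
      unfolding weighted_le_def by blast
    have "(b, b') \<in> isomorphic_rel (weighted_cat C)"
      using Y * eq unfolding weighted_classes_def by (meson quotient_eq_iff)
    then obtain h where "h \<in> homset (weighted_cat C) b b'" unfolding isomorphic_rel_def by blast
    with * W.comp_hom show "weighted_le C X Z" unfolding weighted_le_def by blast
  qed
qed

lemma cring_poly_ring: "cring (poly_ring S :: ('e, 'k::comm_ring_1) mpoly ring)"
proof (rule cringI)
  show "abelian_group (poly_ring S :: ('e, 'k) mpoly ring)"
  proof (rule abelian_groupI)
    fix x :: "('e, 'k) mpoly" assume "x \<in> carrier (poly_ring S)"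
    then show "\<exists>y \<in> carrier (poly_ring S). y \<oplus>\<^bsub>poly_ring S\<^esub> x = \<zero>\<^bsub>poly_ring S\<^esub>"
      by (intro bexI[of _ "- x"]) (auto simp: poly_ring_def)
  next
    fix x y :: "('e, 'k) mpoly"
    assume "x \<in> carrier (poly_ring S)" "y \<in> carrier (poly_ring S)"
    then show "x \<oplus>\<^bsub>poly_ring S\<^esub> y \<in> carrier (poly_ring S)"
      using keys_add[of x y] by (auto simp: poly_ring_def)
  qed (auto simp: poly_ring_def add_ac)
  show "comm_monoid (poly_ring S :: ('e, 'k) mpoly ring)"
  proof (rule comm_monoidI)
    fix x y :: "('e, 'k) mpoly"
    assume xy: "x \<in> carrier (poly_ring S)" "y \<in> carrier (poly_ring S)"
    show "x \<otimes>\<^bsub>poly_ring S\<^esub> y \<in> carrier (poly_ring S)"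
      unfolding poly_ring_def
    proof (clarsimp)
      fix m i assume "m \<in> Poly_Mapping.keys (x * y)" and i: "i \<in> Poly_Mapping.keys m"
      then obtain a b where ab: "m = a + b" "a \<in> Poly_Mapping.keys x" "b \<in> Poly_Mapping.keys y"
        using keys_mult[of x y] by blast
      then have "i \<in> Poly_Mapping.keys a \<union> Poly_Mapping.keys b" using i keys_add[of a b] by blast
      then show "i \<in> S" using ab xy by (auto simp: poly_ring_def)
    qed
  qed (auto simp: poly_ring_def algebra_simps)
qed (auto simp: poly_ring_def algebra_simps)

lemma pushforward_pvar: "pushforward f (pvar i) = (pvar (f i) :: ('f, 'k::comm_ring_1) mpoly)"
  by (simp add: pushforward_def pvar_def pconst_def)

lemma pushforward_pconst: "pushforward f (pconst c) = pconst c"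
  by (cases "c = 0") (simp_all add: pushforward_def pconst_def)

lemma pushforward_superset:
  assumes "finite K" "Poly_Mapping.keys p \<subseteq> K"
  shows "pushforward f p = (\<Sum>m \<in> K. pconst (Poly_Mapping.lookup p m) *
           (\<Prod>i \<in> Poly_Mapping.keys m. pvar (f i) ^ Poly_Mapping.lookup m i))"
  unfolding pushforward_def
  by (rule sum.mono_neutral_left)
    (use assms in \<open>auto simp: pconst_def not_in_keys_iff_lookup_eq_zero\<close>)

lemma pushforward_add: "pushforward f (p + q) = pushforward f p + pushforward f q"
proof -
  let ?K = "Poly_Mapping.keys p \<union> Poly_Mapping.keys q"
  show ?thesis
    using keys_add[of p q]
    by (simp add: pushforward_superset[of ?K] lookup_add pconst_def single_add distrib_right
        sum.distrib)
qed

lemma pushforward_sum: "pushforward f (\<Sum>x \<in> T. g x) = (\<Sum>x \<in> T. pushforward f (g x))"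
proof (induction T rule: infinite_finite_induct)
  case (insert x T)
  then show ?case by (simp add: pushforward_add)
qed (simp_all add: pushforward_def)

lemma mpoly_as_sum:
  "p = (\<Sum>m \<in> Poly_Mapping.keys p. Poly_Mapping.single m (Poly_Mapping.lookup p m))"
  by (rule poly_mapping_eqI) (auto simp: lookup_sum lookup_single when_def not_in_keys_iff_lookup_eq_zero)

lemma pushforward_mult:
  fixes p q :: "('e, 'k::comm_ring_1) mpoly" and f :: "'e \<Rightarrow> 'f"
  shows "pushforward f (p * q) = pushforward f p * pushforward f q"
proof -
  let ?M = "\<lambda>m. \<Prod>i \<in> Poly_Mapping.keys m. pvar (f i) ^ Poly_Mapping.lookup m i"
  have M_superset: "?M m = (\<Prod>i \<in> K. pvar (f i) ^ Poly_Mapping.lookup m i)"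
    if "finite K" "Poly_Mapping.keys m \<subseteq> K" for m K
    by (rule prod.mono_neutral_left)
      (use that in \<open>auto simp: not_in_keys_iff_lookup_eq_zero\<close>)
  have M_add: "?M (m + n) = ?M m * ?M n" for m n
  proof -
    let ?K = "Poly_Mapping.keys m \<union> Poly_Mapping.keys n"
    have K: "finite ?K" by simp
    show ?thesis
      unfolding M_superset[OF K keys_add] M_superset[OF K Un_upper1] M_superset[OF K Un_upper2]
      by (simp add: lookup_add power_add prod.distrib)
  qed
  have single: "pushforward f (Poly_Mapping.single m c) = pconst c * ?M m"
    for m :: "'e \<Rightarrow>\<^sub>0 nat" and c :: 'k
    by (cases "c = 0") (simp_all add: pushforward_def pconst_def)
  have mult_single':
    "pushforward f (Poly_Mapping.single m c * Poly_Mapping.single n d) =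
     pushforward f (Poly_Mapping.single m c) * pushforward f (Poly_Mapping.single n d)"
    for m n :: "'e \<Rightarrow>\<^sub>0 nat" and c d :: 'k
  proof -
    have "(pconst (c * d) :: ('f, 'k) mpoly) = pconst c * pconst d" by (simp add: pconst_def mult_single)
    then show ?thesis by (simp only: mult_single single M_add ac_simps)
  qed
  have "pushforward f (p * q) = pushforward f
     ((\<Sum>m \<in> Poly_Mapping.keys p. Poly_Mapping.single m (Poly_Mapping.lookup p m)) *
      (\<Sum>n \<in> Poly_Mapping.keys q. Poly_Mapping.single n (Poly_Mapping.lookup q n)))"
    using mpoly_as_sum[of p] mpoly_as_sum[of q] by simp
  also have "\<dots> =
     pushforward f (\<Sum>m \<in> Poly_Mapping.keys p. Poly_Mapping.single m (Poly_Mapping.lookup p m)) *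
     pushforward f (\<Sum>n \<in> Poly_Mapping.keys q. Poly_Mapping.single n (Poly_Mapping.lookup q n))"
    by (simp add: sum_product pushforward_sum mult_single')
  finally show ?thesis using mpoly_as_sum[of p] mpoly_as_sum[of q] by simp
qed

end

theory Submission
  imports Defs "HOL-Algebra.QuotRing"
begin

text \<open>
  Let \<open>D\<close> be a G-category mapping onto \<open>C\<close>.  An ideal system on \<open>C\<close> pulls back to one on \<open>D\<close>
  along the bijections of underlying sets, and because every object of \<open>C\<close> is isomorphic to one in
  the image, an ascending chain on \<open>C\<close> stabilises as soon as its pullback does
  (\<open>noetherian_transfer\<close>).  So the task is to prove that \<open>D\<close> itself is noetherian, and this is a
  Groebner basis argument (\<open>G_category_noetherian\<close>).

  The ordering of \<open>D\<close> gives a lexicographic order on the monomials of every \<open>R_A\<close>.  Since the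
  morphisms of \<open>D\<close> preserve the orderings of the variables, the induced ring homomorphisms strictly
  preserve the monomial orders and so send leading monomials to leading monomials.  A
  monomial of \<open>R_A\<close> is the same thing as a weighting of \<open>A\<close>, and the leading monomials of an
  ideal system form an upward closed set of weighted objects: push an element forward along a
  morphism and multiply by the missing monomial (\<open>leading_objects_upward_closed\<close>).  In a
  well-quasi-order, ascending chains of upward closed sets stabilise, so for an ascending chain of
  ideal systems the sets of leading monomials are eventually constant, with a bound that does not
  depend on the object (\<open>leading_objects_stabilise\<close>).

  It remains to see that nested ideals of \<open>R_A\<close> with the same leading monomials coincide, by the
  usual cancellation of leading terms (\<open>ideal_eq_if_leading_monoms\<close>).  This needs the monomial
  order on \<open>R_A\<close> to be well-founded, for which the wqo hypothesis is used a second time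
  (\<open>wf_monomial_order\<close>): every infinite sequence of weightings of \<open>A\<close> contains a pair related by
  an endomorphism of \<open>A\<close>, and an order-preserving injection of a finite chain to itself is the
  identity, so the later weighting dominates the earlier one pointwise.
\<close>

section \<open>Renaming variables in monomials and polynomials\<close>

text \<open>Besides describing the action of morphisms on monomials, this serves to define the monomial
  orders: renaming variables by an injection into the natural numbers lands in a type that carries a
  lexicographic linear order.\<close>

definition rename_monom :: "('e \<Rightarrow> 'f) \<Rightarrow> ('e \<Rightarrow>\<^sub>0 nat) \<Rightarrow> ('f \<Rightarrow>\<^sub>0 nat)" where
  "rename_monom f m =
     (\<Sum>i \<in> Poly_Mapping.keys m. Poly_Mapping.single (f i) (Poly_Mapping.lookup m i))"

lemma lookup_rename_monom:
  assumes "inj_on f S" "Poly_Mapping.keys m \<subseteq> S" "i \<in> S"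
  shows "Poly_Mapping.lookup (rename_monom f m) (f i) = Poly_Mapping.lookup m i"
proof -
  have "Poly_Mapping.lookup (rename_monom f m) (f i) =
      (\<Sum>j \<in> Poly_Mapping.keys m. if j = i then Poly_Mapping.lookup m j else 0)"
    unfolding rename_monom_def lookup_sum lookup_single when_def
    by (rule sum.cong) (use assms in \<open>auto dest: inj_onD\<close>)
  then show ?thesis by (simp add: in_keys_iff)
qed

lemma keys_rename_monom_subset: "Poly_Mapping.keys (rename_monom f m) \<subseteq> f ` Poly_Mapping.keys m"
proof
  fix k assume "k \<in> Poly_Mapping.keys (rename_monom f m)"
  then have "(\<Sum>j \<in> Poly_Mapping.keys m. Poly_Mapping.lookup m j when f j = k) \<noteq> 0"
    by (simp add: rename_monom_def lookup_sum lookup_single in_keys_iff)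
  then obtain j where "j \<in> Poly_Mapping.keys m" "(Poly_Mapping.lookup m j when f j = k) \<noteq> 0"
    by (meson sum.neutral)
  then show "k \<in> f ` Poly_Mapping.keys m" by (auto simp: when_def split: if_splits)
qed

lemma lookup_rename_monom_outside:
  assumes "Poly_Mapping.keys m \<subseteq> S" "k \<notin> f ` S"
  shows "Poly_Mapping.lookup (rename_monom f m) k = 0"
proof -
  have "k \<notin> Poly_Mapping.keys (rename_monom f m)"
    using keys_rename_monom_subset[of f m] assms by blast
  then show ?thesis by (simp add: in_keys_iff)
qed

lemma inj_on_rename_monom:
  assumes "inj_on f S"
  shows "inj_on (rename_monom f) {m. Poly_Mapping.keys m \<subseteq> S}"
proof (rule inj_onI, clarsimp)
  fix m m' assume m: "Poly_Mapping.keys m \<subseteq> S" "Poly_Mapping.keys m' \<subseteq> S"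
    and eq: "rename_monom f m = rename_monom f m'"
  show "m = m'"
  proof (rule poly_mapping_eqI)
    fix i
    show "Poly_Mapping.lookup m i = Poly_Mapping.lookup m' i"
    proof (cases "i \<in> S")
      case True
      then show ?thesis using lookup_rename_monom[OF assms m(1)] lookup_rename_monom[OF assms m(2)] eq
        by metis
    next
      case False
      then have "i \<notin> Poly_Mapping.keys m" "i \<notin> Poly_Mapping.keys m'" using m by auto
      then show ?thesis by (simp add: in_keys_iff)
    qed
  qed
qed

lemma pushforward_monomials:
  fixes f :: "'e \<Rightarrow> 'f" and p :: "('e, 'k::comm_ring_1) mpoly"
  shows "pushforward f p = (\<Sum>m \<in> Poly_Mapping.keys p.
     Poly_Mapping.single (rename_monom f m) (Poly_Mapping.lookup p m))"
proof -
  have power: "pvar i ^ n = (Poly_Mapping.single (Poly_Mapping.single i n) 1 :: ('f, 'k) mpoly)"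
    for i :: 'f and n
    by (induction n) (simp_all add: pvar_def mult_single flip: single_add)
  have prod: "(\<Prod>i \<in> K. Poly_Mapping.single (g i) 1) =
      (Poly_Mapping.single (\<Sum>i \<in> K. g i) 1 :: ('f, 'k) mpoly)" for K and g :: "'e \<Rightarrow> 'f \<Rightarrow>\<^sub>0 nat"
    by (induction K rule: infinite_finite_induct) (simp_all add: mult_single)
  show ?thesis
    by (simp add: pushforward_def power prod rename_monom_def pconst_def mult_single)
qed

lemma pushforward_cong:
  assumes "p \<in> carrier (poly_ring S)" "\<And>i. i \<in> S \<Longrightarrow> f i = g i"
  shows "pushforward f p = pushforward g p"
  unfolding pushforward_def using assms
  by (intro sum.cong prod.cong arg_cong2[where f = "(*)"]) (auto simp: poly_ring_def subset_iff)

lemma pushforward_prod: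
  fixes f :: "'e \<Rightarrow> 'f" and g :: "'a \<Rightarrow> ('e, 'k::comm_ring_1) mpoly"
  shows "pushforward f (\<Prod>x \<in> T. g x) = (\<Prod>x \<in> T. pushforward f (g x))"
proof -
  have one: "pushforward f 1 = (1 :: ('f, 'k) mpoly)"
    using pushforward_pconst[of f 1] by (simp add: pconst_def)
  show ?thesis by (induction T rule: infinite_finite_induct) (simp_all add: pushforward_mult one)
qed

lemma pushforward_power: "pushforward f (p ^ n) = pushforward f p ^ n"
  using pushforward_prod[of f "\<lambda>_. p" "{..<n}"] by simp

lemma pushforward_comp: "pushforward g (pushforward f p) = pushforward (g \<circ> f) p"
  by (simp add: pushforward_def[of f] pushforward_def[of "g \<circ> f"] pushforward_sum pushforward_mult
      pushforward_prod pushforward_power pushforward_pvar pushforward_pconst)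

lemma rename_monom_ident: "rename_monom (\<lambda>i. i) m = m"
  by (rule poly_mapping_eqI)
    (use lookup_rename_monom[of "\<lambda>i. i" UNIV m] in auto)

lemma pushforward_ident:
  assumes "p \<in> carrier (poly_ring S)" "\<And>i. i \<in> S \<Longrightarrow> f i = i"
  shows "pushforward f p = p"
  using pushforward_cong[OF assms] mpoly_as_sum[of p]
  by (simp add: pushforward_monomials[of "\<lambda>i. i"] rename_monom_ident)

lemma pushforward_carrier:
  assumes "p \<in> carrier (poly_ring S)" "\<And>i. i \<in> S \<Longrightarrow> f i \<in> T"
  shows "pushforward f p \<in> carrier (poly_ring T)"
proof -
  have "Poly_Mapping.keys n \<subseteq> T" if n: "n \<in> Poly_Mapping.keys (pushforward f p)" for n
  proof -
    have "(\<Sum>m \<in> Poly_Mapping.keys p. Poly_Mapping.lookup p m when rename_monom f m = n) \<noteq> 0"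
      using n by (simp add: pushforward_monomials in_keys_iff lookup_sum lookup_single)
    then obtain m where "m \<in> Poly_Mapping.keys p" "n = rename_monom f m"
      by (metis (mono_tags, lifting) sum.neutral when_neq_zero)
    then show ?thesis using keys_rename_monom_subset[of f m] assms
      by (fastforce simp: poly_ring_def)
  qed
  then show ?thesis by (simp add: poly_ring_def)
qed

section \<open>Leading monomials\<close>

text \<open>For an injection \<open>e\<close> of the variables into the natural numbers, comparing \<open>rename_monom e m\<close>
  and \<open>rename_monom e m'\<close> is comparing \<open>m\<close> and \<open>m'\<close> lexicographically, where the variable with the
  smallest number is the most significant one.\<close>

lemma rename_monom_less_iff:
  fixes e :: "'e \<Rightarrow> nat"
  assumes "inj_on e S" "Poly_Mapping.keys m \<subseteq> S" "Poly_Mapping.keys m' \<subseteq> S"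
  shows "rename_monom e m < rename_monom e m' \<longleftrightarrow>
    (\<exists>i \<in> S. Poly_Mapping.lookup m i < Poly_Mapping.lookup m' i \<and>
      (\<forall>j \<in> S. e j < e i \<longrightarrow> Poly_Mapping.lookup m j = Poly_Mapping.lookup m' j))" (is "?L \<longleftrightarrow> ?R")
proof
  assume ?L
  then obtain k where k: "Poly_Mapping.lookup (rename_monom e m) k < Poly_Mapping.lookup (rename_monom e m') k"
    "\<forall>k' < k. Poly_Mapping.lookup (rename_monom e m) k' = Poly_Mapping.lookup (rename_monom e m') k'"
    by (auto simp: less_poly_mapping.rep_eq less_fun_def)
  have "k \<in> e ` S" using lookup_rename_monom_outside[OF assms(3), of k e] k(1) by auto
  then obtain i where i: "i \<in> S" "k = e i" by auto
  show ?R
    using k i by (intro bexI[of _ i]) (auto simp: lookup_rename_monom[OF assms(1,2)] lookup_rename_monom[OF assms(1,3)])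
next
  assume ?R
  then obtain i where i: "i \<in> S" "Poly_Mapping.lookup m i < Poly_Mapping.lookup m' i"
    "\<forall>j \<in> S. e j < e i \<longrightarrow> Poly_Mapping.lookup m j = Poly_Mapping.lookup m' j" by auto
  have "Poly_Mapping.lookup (rename_monom e m) k = Poly_Mapping.lookup (rename_monom e m') k" if "k < e i" for k
  proof (cases "k \<in> e ` S")
    case True
    then show ?thesis using i that
      by (auto simp: lookup_rename_monom[OF assms(1,2)] lookup_rename_monom[OF assms(1,3)])
  qed (simp add: lookup_rename_monom_outside[OF assms(2)] lookup_rename_monom_outside[OF assms(3)])
  then show ?L unfolding less_poly_mapping.rep_eq less_fun_def
    using i(1,2) by (intro exI[of _ "e i"]) (auto simp: lookup_rename_monom[OF assms(1,2)] lookup_rename_monom[OF assms(1,3)])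
qed

text \<open>The substitution along an order-preserving injection followed by multiplication with a monomial
  is strictly monotone: the deciding variable \<open>i\<close> becomes \<open>f i\<close>, and each more significant
  variable of the target either comes from a more significant variable of the source or lies
  outside the image of \<open>f\<close>, where both renamed monomials have exponent zero.\<close>

lemma rename_shift_mono:
  fixes e :: "'e \<Rightarrow> nat" and e' :: "'f \<Rightarrow> nat"
  assumes e: "inj_on e S" and e': "inj_on e' T" and f: "inj_on f S" "f ` S \<subseteq> T"
    and mono: "\<And>x y. x \<in> S \<Longrightarrow> y \<in> S \<Longrightarrow> e x < e y \<Longrightarrow> e' (f x) < e' (f y)"
    and m: "Poly_Mapping.keys m \<subseteq> S" "Poly_Mapping.keys m' \<subseteq> S" and t: "Poly_Mapping.keys t \<subseteq> T"
    and less: "rename_monom e m < rename_monom e m'"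
  shows "rename_monom e' (rename_monom f m + t) < rename_monom e' (rename_monom f m' + t)"
proof -
  obtain i where i: "i \<in> S" "Poly_Mapping.lookup m i < Poly_Mapping.lookup m' i"
    "\<forall>j \<in> S. e j < e i \<longrightarrow> Poly_Mapping.lookup m j = Poly_Mapping.lookup m' j"
    using less rename_monom_less_iff[OF e m] by auto
  have keys: "Poly_Mapping.keys (rename_monom f n + t) \<subseteq> T" if "Poly_Mapping.keys n \<subseteq> S" for n
    using keys_add[of "rename_monom f n" t] keys_rename_monom_subset[of f n] that t f(2) by blast
  have eq: "Poly_Mapping.lookup (rename_monom f m) j = Poly_Mapping.lookup (rename_monom f m') j"
    if j: "e' j < e' (f i)" for j
  proof (cases "j \<in> f ` S")
    case True
    then obtain l where l: "l \<in> S" "j = f l" by auto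
    have "e l \<noteq> e i" using j l i(1) inj_onD[OF e] by auto
    moreover have "\<not> e i < e l" using mono[OF i(1) l(1)] j l by auto
    ultimately have "e l < e i" by simp
    then show ?thesis using i(3) l by (simp add: lookup_rename_monom[OF f(1) m(1)] lookup_rename_monom[OF f(1) m(2)])
  qed (simp add: lookup_rename_monom_outside[OF m(1)] lookup_rename_monom_outside[OF m(2)])
  show ?thesis
    unfolding rename_monom_less_iff[OF e' keys[OF m(1)] keys[OF m(2)]]
    using i(1,2) f(2) eq
    by (intro bexI[of _ "f i"]) (auto simp: lookup_add lookup_rename_monom[OF f(1) m(1)] lookup_rename_monom[OF f(1) m(2)])
qed

definition leading_monom :: "('e \<Rightarrow> nat) \<Rightarrow> ('e, 'k::comm_ring_1) mpoly \<Rightarrow> ('e \<Rightarrow>\<^sub>0 nat) \<Rightarrow> bool" where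
  "leading_monom e p m \<longleftrightarrow> m \<in> Poly_Mapping.keys p \<and>
     (\<forall>m' \<in> Poly_Mapping.keys p. rename_monom e m' \<le> rename_monom e m)"

lemma leading_monom_exists:
  assumes "p \<noteq> 0"
  obtains m where "leading_monom e p m"
proof -
  let ?K = "rename_monom e ` Poly_Mapping.keys p"
  have "Max ?K \<in> ?K" using assms by (intro Max_in) auto
  then obtain m where "m \<in> Poly_Mapping.keys p" "rename_monom e m = Max ?K" by auto
  then have "leading_monom e p m" by (simp add: leading_monom_def)
  then show ?thesis by (rule that)
qed

text \<open>A strictly monotone map on the monomials cannot merge two terms of a polynomial, so no
  cancellation occurs and the leading monomial is carried along.\<close>

lemma leading_monom_shift:
  fixes e :: "'e \<Rightarrow> nat" and e' :: "'f \<Rightarrow> nat"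
  assumes e: "inj_on e S" and e': "inj_on e' T" and f: "inj_on f S" "f ` S \<subseteq> T"
    and mono: "\<And>x y. x \<in> S \<Longrightarrow> y \<in> S \<Longrightarrow> e x < e y \<Longrightarrow> e' (f x) < e' (f y)"
    and p: "p \<in> carrier (poly_ring S)" and t: "Poly_Mapping.keys t \<subseteq> T"
    and lead: "leading_monom e p m"
  shows "leading_monom e' (Poly_Mapping.single t 1 * pushforward f p) (rename_monom f m + t)"
proof -
  let ?g = "\<lambda>m. rename_monom f m + t" and ?q = "Poly_Mapping.single t 1 * pushforward f p"
  have keys: "Poly_Mapping.keys n \<subseteq> S" if "n \<in> Poly_Mapping.keys p" for n
    using p that by (auto simp: poly_ring_def)
  have m: "m \<in> Poly_Mapping.keys p" and max: "n \<in> Poly_Mapping.keys p \<Longrightarrow> rename_monom e n \<le> rename_monom e m" for n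
    using lead by (auto simp: leading_monom_def)
  have q: "?q = (\<Sum>n \<in> Poly_Mapping.keys p. Poly_Mapping.single (?g n) (Poly_Mapping.lookup p n))"
    by (simp add: pushforward_monomials sum_distrib_left mult_single add.commute)
  have inj: "n = n'" if "n \<in> Poly_Mapping.keys p" "n' \<in> Poly_Mapping.keys p" "?g n = ?g n'" for n n'
    using inj_onD[OF inj_on_rename_monom[OF f(1)], of n n'] that keys by auto
  have "Poly_Mapping.lookup ?q (?g m) = (\<Sum>n \<in> Poly_Mapping.keys p. if n = m then Poly_Mapping.lookup p n else 0)"
    unfolding q lookup_sum lookup_single when_def
    by (rule sum.cong) (use inj m in auto)
  also have "\<dots> = Poly_Mapping.lookup p m" using m by simp
  finally have "?g m \<in> Poly_Mapping.keys ?q" using m by (simp add: in_keys_iff)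
  moreover have "rename_monom e' n' \<le> rename_monom e' (?g m)" if "n' \<in> Poly_Mapping.keys ?q" for n'
  proof -
    have "(\<Sum>n \<in> Poly_Mapping.keys p. Poly_Mapping.lookup p n when ?g n = n') \<noteq> 0"
      using that unfolding q by (simp add: in_keys_iff lookup_sum lookup_single)
    then obtain n where n: "n \<in> Poly_Mapping.keys p" "n' = ?g n"
      by (metis (mono_tags, lifting) sum.neutral when_neq_zero)
    show ?thesis
    proof (cases "rename_monom e n < rename_monom e m")
      case True
      then show ?thesis using rename_shift_mono[OF e e' f mono keys[OF n(1)] keys[OF m] t] n(2) by simp
    next
      case False
      then have "rename_monom e n = rename_monom e m" using max[OF n(1)] by simp
      then have "n = m" using inj_onD[OF inj_on_rename_monom[OF e]] keys n(1) m by blast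
      then show ?thesis using n by simp
    qed
  qed
  ultimately show ?thesis by (simp add: leading_monom_def)
qed

section \<open>Ideals in polynomial rings\<close>

lemma poly_ring_ideal_closed:
  fixes S :: "'e set" and I :: "('e, 'k::comm_ring_1) mpoly set"
  assumes "ideal I (poly_ring S)"
  shows "p \<in> I \<Longrightarrow> p \<in> carrier (poly_ring S)" and "0 \<in> I"
    and "p \<in> I \<Longrightarrow> q \<in> I \<Longrightarrow> p + q \<in> I"
    and "p \<in> I \<Longrightarrow> Poly_Mapping.keys m \<subseteq> S \<Longrightarrow> Poly_Mapping.single m c * p \<in> I"
proof -
  interpret ideal I "poly_ring S" by (rule assms)
  show "p \<in> I \<Longrightarrow> p \<in> carrier (poly_ring S)" by (rule a_Hcarr)
  show "0 \<in> I" using additive_subgroup.zero_closed[OF is_additive_subgroup] by (simp add: poly_ring_def)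
  show "p \<in> I \<Longrightarrow> q \<in> I \<Longrightarrow> p + q \<in> I" using additive_subgroup.a_closed[OF is_additive_subgroup, of p q] by (simp add: poly_ring_def)
  show "Poly_Mapping.single m c * p \<in> I" if "p \<in> I" "Poly_Mapping.keys m \<subseteq> S"
    using I_l_closed[of p "Poly_Mapping.single m c"] that by (simp add: poly_ring_def)
qed

lemma ideal_pushforward_vimage:
  fixes f :: "'e \<Rightarrow> 'f" and I :: "('f, 'k::comm_ring_1) mpoly set"
  assumes I: "ideal I (poly_ring T)" and f: "\<And>i. i \<in> S \<Longrightarrow> f i \<in> T"
  shows "ideal {p \<in> carrier (poly_ring S). pushforward f p \<in> I} (poly_ring S)"
proof -
  interpret S: cring "poly_ring S :: ('e, 'k) mpoly ring" by (rule cring_poly_ring)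
  interpret T: cring "poly_ring T :: ('f, 'k) mpoly ring" by (rule cring_poly_ring)
  interpret I: ideal I "poly_ring T" by (rule I)
  have hom: "ring_hom_ring (poly_ring S) (poly_ring T) (pushforward f :: ('e, 'k) mpoly \<Rightarrow> _)"
  proof (rule ring_hom_ringI)
    show "pushforward f p \<in> carrier (poly_ring T)" if "p \<in> carrier (poly_ring S)"
      for p :: "('e, 'k) mpoly" using that f by (rule pushforward_carrier)
    show "pushforward f \<one>\<^bsub>poly_ring S\<^esub> = (\<one>\<^bsub>poly_ring T\<^esub> :: ('f, 'k) mpoly)"
      using pushforward_pconst[of f "1 :: 'k"] by (simp add: pconst_def poly_ring_def)
  qed (auto simp: poly_ring_def pushforward_mult pushforward_add S.ring_axioms[unfolded poly_ring_def]
      T.ring_axioms[unfolded poly_ring_def])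
  show ?thesis using ring_hom_ring.ideal_vimage[OF hom I] .
qed

section \<open>Orderings and well-quasi-orders of weighted objects\<close>

text \<open>On a finite chain, this numbers the elements in increasing order.  It turns the ordering of a
  category into maps to the natural numbers by which the variables of each ring are compared.\<close>

definition rank :: "'a rel \<Rightarrow> 'a \<Rightarrow> nat" where
  "rank r x = card {y. (y, x) \<in> r}"

lemma rank_less_iff:
  assumes "finite S" "linear_order_on S r" "x \<in> S" "y \<in> S"
  shows "rank r x < rank r y \<longleftrightarrow> (x, y) \<in> r \<and> x \<noteq> y"
proof -
  have tr: "trans r" and sub: "r \<subseteq> S \<times> S" and anti: "antisym r" and tot: "total_on S r"
    and refl: "refl_on S r" using assms(2) by (auto simp: order_on_defs)
  have less: "rank r u < rank r v" if uv: "(u, v) \<in> r" "u \<noteq> v" for u v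
    unfolding rank_def
  proof (rule psubset_card_mono)
    show "finite {w. (w, v) \<in> r}" by (rule finite_subset[OF _ assms(1)]) (use sub in auto)
    have "(v, v) \<in> r" using uv sub refl by (auto simp: refl_on_def)
    moreover have "(v, u) \<notin> r" using uv anti by (auto dest: antisymD)
    moreover have "{w. (w, u) \<in> r} \<subseteq> {w. (w, v) \<in> r}" using transD[OF tr] uv(1) by auto
    ultimately show "{w. (w, u) \<in> r} \<subset> {w. (w, v) \<in> r}" by blast
  qed
  show ?thesis
  proof
    assume "rank r x < rank r y"
    then show "(x, y) \<in> r \<and> x \<noteq> y"
      using less[of y x] tot assms(3,4) by (fastforce simp: total_on_def)
  qed (use less in auto)
qed

lemma inj_on_rank:
  assumes "finite S" "linear_order_on S r"
  shows "inj_on (rank r) S"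
proof (rule inj_onI)
  fix x y assume "x \<in> S" "y \<in> S" "rank r x = rank r y"
  then show "x = y"
    using rank_less_iff[OF assms, of x y] rank_less_iff[OF assms, of y x] assms(2)
    by (auto simp: order_on_defs total_on_def)
qed

lemma rank_morphism_mono:
  assumes C: "fi_concrete C" and r: "ordering_on C r"
    and \<phi>: "\<phi> \<in> homset C A B" and xy: "x \<in> pts C A" "y \<in> pts C A" "rank (r A) x < rank (r A) y"
  shows "rank (r B) (fn C \<phi> x) < rank (r B) (fn C \<phi> y)"
proof -
  interpret category C by (rule fi_concreteD(1)[OF C])
  have obj: "A \<in> Obj C" "B \<in> Obj C" using \<phi> dom_obj cod_obj by (auto simp: homset_def)
  have lin: "linear_order_on (pts C A) (r A)" "linear_order_on (pts C B) (r B)"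
    using r obj by (auto simp: ordering_on_def)
  have f: "fn C \<phi> \<in> pts C A \<rightarrow>\<^sub>E pts C B" "inj_on (fn C \<phi>) (pts C A)"
    using fi_concreteD(3)[OF C \<phi>] by auto
  have "(x, y) \<in> r A" "x \<noteq> y"
    using rank_less_iff[OF fi_concreteD(2)[OF C obj(1)] lin(1) xy(1,2)] xy(3) by auto
  then have "(fn C \<phi> x, fn C \<phi> y) \<in> r B" "fn C \<phi> x \<noteq> fn C \<phi> y"
    using r obj \<phi> inj_onD[OF f(2)] xy by (fastforce simp: ordering_on_def)+
  then show ?thesis
    using rank_less_iff[OF fi_concreteD(2)[OF C obj(2)] lin(2)] f(1) xy by (simp add: PiE_iff)
qed

text \<open>A moved point \<open>x\<close> of least rank has no room: neither \<open>f x\<close> nor the preimage of \<open>x\<close> can be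
  smaller, since smaller points are fixed, and if both are larger then monotonicity fails.\<close>

lemma finite_order_endo_ident:
  fixes e :: "'a \<Rightarrow> nat"
  assumes "finite S" "inj_on e S" "f ` S \<subseteq> S"
    and mono: "\<And>x y. x \<in> S \<Longrightarrow> y \<in> S \<Longrightarrow> e x < e y \<Longrightarrow> e (f x) < e (f y)"
    and "x \<in> S"
  shows "f x = x"
  using \<open>x \<in> S\<close>
proof (induction "e x" arbitrary: x rule: less_induct)
  case (less x)
  have inj: "inj_on f S"
  proof (rule inj_onI)
    fix u v assume "u \<in> S" "v \<in> S" "f u = f v"
    then show "u = v" using mono[of u v] mono[of v u] inj_onD[OF assms(2), of u v] by fastforce
  qed
  have surj: "f ` S = S" using endo_inj_surj[OF assms(1,3) inj] .
  show ?case
  proof (rule ccontr)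
    assume ne: "f x \<noteq> x"
    obtain z where z: "z \<in> S" "f z = x" using surj less.prems by (metis imageE)
    have fx: "f x \<in> S" using less.prems assms(3) by blast
    have "\<not> e (f x) < e x" using less.hyps[of "f x"] fx ne inj_onD[OF inj] less.prems by blast
    moreover have "\<not> e z < e x" using less.hyps[of z] z ne by auto
    moreover have "e z \<noteq> e x" using inj_onD[OF assms(2)] z ne less.prems by metis
    ultimately show False using mono[OF less.prems z(1)] z(2) by simp
  qed
qed

text \<open>The wqo hypothesis is stated for isomorphism classes; composing with the isomorphisms to the
  chosen representatives yields a morphism between the representatives themselves.\<close>

lemma G_category_good_pair:
  fixes D :: "('o, 'm, 'e) fi_cat" and A :: "nat \<Rightarrow> 'o" and w :: "nat \<Rightarrow> 'e \<Rightarrow> nat"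
  assumes G: "G_category D" and A: "\<And>n. A n \<in> Obj D"
  obtains i j \<phi> where "i < j" "\<phi> \<in> homset D (A i) (A j)"
    "\<And>x. x \<in> pts D (A i) \<Longrightarrow> w i x \<le> w j (fn D \<phi> x)"
proof -
  have C: "fi_concrete D" using G by (simp add: G_category_def)
  let ?W = "weighted_cat D"
  interpret W: category ?W by (rule category_weighted[OF C])
  note eq = W.equiv_isomorphic_rel
  define X where "X n = (A n, restrict (w n) (pts D (A n)))" for n
  have X: "X n \<in> Obj ?W" for n using A by (auto simp: X_def weighted_cat_def Let_def)
  have "range (\<lambda>n. isomorphic_rel ?W `` {X n}) \<subseteq> weighted_classes D"
    using X by (auto simp: weighted_classes_def intro: quotientI)
  then obtain i j where ij: "i < j"
    "weighted_le D (isomorphic_rel ?W `` {X i}) (isomorphic_rel ?W `` {X j})"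
    using G unfolding G_category_def wqo_on_def by blast
  then obtain a b h where ab: "(X i, a) \<in> isomorphic_rel ?W" "(X j, b) \<in> isomorphic_rel ?W"
    "h \<in> homset ?W a b" unfolding weighted_le_def by blast
  have "(b, X j) \<in> isomorphic_rel ?W" using ab(2) eq by (meson equivE symD)
  then obtain g f where "g \<in> homset ?W b (X j)" "f \<in> homset ?W (X i) a"
    using ab(1) unfolding isomorphic_rel_def by blast
  then have "Comp ?W g (Comp ?W h f) \<in> homset ?W (X i) (X j)"
    using ab(3) W.comp_hom by blast
  then obtain \<phi> where "\<phi> \<in> homset D (A i) (A j)"
    "\<forall>x \<in> pts D (A i). restrict (w i) (pts D (A i)) x \<le> restrict (w j) (pts D (A j)) (fn D \<phi> x)"
    unfolding X_def homset_weighted by blast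
  moreover from this(1) have "fn D \<phi> x \<in> pts D (A j)" if "x \<in> pts D (A i)" for x
    using fi_concreteD(3)[OF C] that by blast
  ultimately show ?thesis using that[OF ij(1)] by simp
qed

text \<open>In a strictly decreasing sequence of monomials on \<open>A\<close>, the wqo hypothesis provides \<open>i < j\<close> and an
  endomorphism of \<open>A\<close> comparing the \<open>i\<close>-th weighting with the \<open>j\<close>-th.  The endomorphism acts as the
  identity, so the exponents only grow from \<open>i\<close> to \<open>j\<close>, contradicting the descent.\<close>

lemma wf_monomial_order:
  fixes D :: "('o, 'm, 'e) fi_cat"
  assumes G: "G_category D" and r: "ordering_on D r" and A: "A \<in> Obj D"
  shows "wf {(m, m'). Poly_Mapping.keys m \<subseteq> pts D A \<and> Poly_Mapping.keys m' \<subseteq> pts D A \<and>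
    rename_monom (rank (r A)) m < rename_monom (rank (r A)) m'}" (is "wf ?R")
  unfolding wf_iff_no_infinite_down_chain
proof
  assume "\<exists>m. \<forall>i. (m (Suc i), m i) \<in> ?R"
  then obtain m where m: "\<And>i. (m (Suc i), m i) \<in> ?R" by blast
  have C: "fi_concrete D" using G by (simp add: G_category_def)
  have fin: "finite (pts D A)" by (rule fi_concreteD(2)[OF C A])
  have inj: "inj_on (rank (r A)) (pts D A)"
    using inj_on_rank[OF fin] r A by (simp add: ordering_on_def)
  have keys: "Poly_Mapping.keys (m i) \<subseteq> pts D A" for i using m[of i] by auto
  have dec: "rename_monom (rank (r A)) (m j) < rename_monom (rank (r A)) (m i)" if "i < j" for i j
    using that
  proof (induction rule: less_Suc_induct)
    case (1 i)
    then show ?case using m[of i] by simp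
  qed simp
  obtain i j \<phi> where ij: "i < j" "\<phi> \<in> homset D A A"
    and le: "\<And>x. x \<in> pts D A \<Longrightarrow> Poly_Mapping.lookup (m i) x \<le> Poly_Mapping.lookup (m j) (fn D \<phi> x)"
    using G_category_good_pair[OF G, of "\<lambda>_. A" "\<lambda>n. Poly_Mapping.lookup (m n)"] A by blast
  have sub: "fn D \<phi> ` pts D A \<subseteq> pts D A" using fi_concreteD(3)[OF C ij(2)] by auto
  have "fn D \<phi> x = x" if "x \<in> pts D A" for x
    using finite_order_endo_ident[OF fin inj sub rank_morphism_mono[OF C r ij(2)] that] .
  then have "Poly_Mapping.lookup (m i) x \<le> Poly_Mapping.lookup (m j) x" if "x \<in> pts D A" for x
    using le[OF that] that by simp
  moreover obtain x where "x \<in> pts D A" "Poly_Mapping.lookup (m j) x < Poly_Mapping.lookup (m i) x"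
    using dec[OF ij(1)] rename_monom_less_iff[OF inj keys keys] by blast
  ultimately show False by fastforce
qed

section \<open>Noetherianity of G-categories\<close>

definition leading_objects ::
    "('o, 'm, 'e) fi_cat \<Rightarrow> ('o \<Rightarrow> 'e rel) \<Rightarrow> ('o \<Rightarrow> ('e, 'k::comm_ring_1) mpoly set)
      \<Rightarrow> ('o \<times> ('e \<Rightarrow>\<^sub>0 nat)) set" where
  "leading_objects D r I = {(A, m). A \<in> Obj D \<and> (\<exists>p \<in> I A. leading_monom (rank (r A)) p m)}"

text \<open>If \<open>p\<close> has leading monomial \<open>m\<close>, then its image under \<open>\<phi>\<close> has leading monomial the image of
  \<open>m\<close>; this divides \<open>n\<close> exactly because \<open>\<phi>\<close> is a morphism of weighted objects, and multiplying
  by the quotient stays in the ideal.\<close>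

lemma leading_objects_upward_closed:
  fixes D :: "('o, 'm, 'e) fi_cat" and I :: "'o \<Rightarrow> ('e, 'k::comm_ring_1) mpoly set"
  assumes C: "fi_concrete D" and r: "ordering_on D r" and I: "ideal_system D I"
    and lead: "(A, m) \<in> leading_objects D r I" and n: "Poly_Mapping.keys n \<subseteq> pts D B"
    and \<phi>: "\<phi> \<in> homset D A B"
    and le: "\<And>x. x \<in> pts D A \<Longrightarrow> Poly_Mapping.lookup m x \<le> Poly_Mapping.lookup n (fn D \<phi> x)"
  shows "(B, n) \<in> leading_objects D r I"
proof -
  interpret category D by (rule fi_concreteD(1)[OF C])
  have obj: "A \<in> Obj D" "B \<in> Obj D" using \<phi> dom_obj cod_obj by (auto simp: homset_def)
  have ideal: "ideal (I A) (poly_ring (pts D A))" "ideal (I B) (poly_ring (pts D B))"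
    using I obj by (auto simp: ideal_system_def R_obj_def)
  let ?f = "fn D \<phi>"
  have f: "inj_on ?f (pts D A)" "?f ` pts D A \<subseteq> pts D B" using fi_concreteD(3)[OF C \<phi>] by auto
  have inj: "inj_on (rank (r A)) (pts D A)" "inj_on (rank (r B)) (pts D B)"
    using inj_on_rank fi_concreteD(2)[OF C] r obj by (auto simp: ordering_on_def)
  obtain p where p: "p \<in> I A" "leading_monom (rank (r A)) p m"
    using lead by (auto simp: leading_objects_def)
  have pc: "p \<in> carrier (poly_ring (pts D A))" using poly_ring_ideal_closed(1)[OF ideal(1) p(1)] .
  have m: "Poly_Mapping.keys m \<subseteq> pts D A"
    using pc p(2) by (auto simp: poly_ring_def leading_monom_def)
  \<comment> \<open>the quotient monomial; subtraction of exponents is truncated, hence the pointwise bound below\<close>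
  define t where "t = n - rename_monom ?f m"
  have "Poly_Mapping.lookup (rename_monom ?f m) y \<le> Poly_Mapping.lookup n y" for y
    using le lookup_rename_monom[OF f(1) m] lookup_rename_monom_outside[OF m, of y ?f]
    by (cases "y \<in> ?f ` pts D A") auto
  then have n_eq: "n = rename_monom ?f m + t"
    by (intro poly_mapping_eqI) (simp add: t_def lookup_add lookup_minus)
  have t: "Poly_Mapping.keys t \<subseteq> pts D B"
    using n by (force simp: t_def in_keys_iff lookup_minus)
  have "R_arr D \<phi> ` I A \<subseteq> I B" using I obj \<phi> by (simp add: ideal_system_def)
  then have "pushforward ?f p \<in> I B" using p(1) by (auto simp: R_arr_def)
  then have "Poly_Mapping.single t 1 * pushforward ?f p \<in> I B"
    using poly_ring_ideal_closed(4)[OF ideal(2)] t by blast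
  moreover have "leading_monom (rank (r B)) (Poly_Mapping.single t 1 * pushforward ?f p) n"
    unfolding n_eq
    by (rule leading_monom_shift[OF inj f rank_morphism_mono[OF C r \<phi>] pc t p(2)])
  ultimately show ?thesis using obj by (auto simp: leading_objects_def)
qed

text \<open>Otherwise choose indices \<open>s 0 \<le> s 1 \<le> \<dots>\<close> such that a new leading monomial \<open>m k\<close> on \<open>A k\<close>
  appears between \<open>s k\<close> and \<open>s (k + 1)\<close>.  A good pair \<open>i < j\<close> then forces the \<open>j\<close>-th monomial to be a
  leading monomial already at stage \<open>s j\<close>, because the \<open>i\<close>-th one is and these sets are upward
  closed.\<close>

lemma leading_objects_stabilise:
  fixes D :: "('o, 'm, 'e) fi_cat" and J :: "nat \<Rightarrow> 'o \<Rightarrow> ('e, 'k::comm_ring_1) mpoly set"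
  assumes G: "G_category D" and r: "ordering_on D r" and J: "\<And>n. ideal_system D (J n)"
    and mono: "\<And>n A. A \<in> Obj D \<Longrightarrow> J n A \<subseteq> J (Suc n) A"
  obtains N where "\<And>n. n \<ge> N \<Longrightarrow> leading_objects D r (J n) \<subseteq> leading_objects D r (J N)"
proof (rule ccontr)
  assume "\<not> thesis"
  then have "\<forall>N. \<exists>n. n \<ge> N \<and> \<not> leading_objects D r (J n) \<subseteq> leading_objects D r (J N)"
    using that by blast
  then obtain g where g: "\<And>N. g N \<ge> N"
    "\<And>N. \<not> leading_objects D r (J (g N)) \<subseteq> leading_objects D r (J N)" by metis
  define s where "s k = (g ^^ k) 0" for k
  have C: "fi_concrete D" using G by (simp add: G_category_def)
  have L_Suc: "leading_objects D r (J n) \<subseteq> leading_objects D r (J (Suc n))" for n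
    using mono by (fastforce simp: leading_objects_def)
  have L_mono: "leading_objects D r (J a) \<subseteq> leading_objects D r (J b)" if "a \<le> b" for a b
    using lift_Suc_mono_le[of "\<lambda>n. leading_objects D r (J n)", OF L_Suc that] .
  have s_mono: "s a \<le> s b" if "a \<le> b" for a b
    using lift_Suc_mono_le[of s, OF _ that] g(1) by (simp add: s_def)
  have "\<forall>k. \<exists>A m. (A, m) \<in> leading_objects D r (J (s (Suc k))) - leading_objects D r (J (s k))"
  proof
    fix k
    show "\<exists>A m. (A, m) \<in> leading_objects D r (J (s (Suc k))) - leading_objects D r (J (s k))"
      using g(2)[of "s k"] by (force simp: s_def)
  qed
  then obtain A m where Am: "\<And>k. (A k, m k) \<in> leading_objects D r (J (s (Suc k)))"
    "\<And>k. (A k, m k) \<notin> leading_objects D r (J (s k))" by (metis DiffD1 DiffD2)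
  have A: "A k \<in> Obj D" for k using Am(1)[of k] by (auto simp: leading_objects_def)
  have m: "Poly_Mapping.keys (m k) \<subseteq> pts D (A k)" for k
  proof -
    obtain p where p: "p \<in> J (s (Suc k)) (A k)" "m k \<in> Poly_Mapping.keys p"
      using Am(1)[of k] by (auto simp: leading_objects_def leading_monom_def)
    have "ideal (J (s (Suc k)) (A k)) (poly_ring (pts D (A k)))"
      using J A by (auto simp: ideal_system_def R_obj_def)
    then have "p \<in> carrier (poly_ring (pts D (A k)))" using p(1) by (rule poly_ring_ideal_closed(1))
    then show ?thesis using p(2) by (auto simp: poly_ring_def)
  qed
  obtain i j \<phi> where ij: "i < j" "\<phi> \<in> homset D (A i) (A j)"
    "\<And>x. x \<in> pts D (A i) \<Longrightarrow> Poly_Mapping.lookup (m i) x \<le> Poly_Mapping.lookup (m j) (fn D \<phi> x)"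
    using G_category_good_pair[OF G, of A "\<lambda>n. Poly_Mapping.lookup (m n)"] A by blast
  have "(A i, m i) \<in> leading_objects D r (J (s j))"
    using Am(1)[of i] L_mono[OF s_mono[of "Suc i" j]] ij(1) by auto
  then have "(A j, m j) \<in> leading_objects D r (J (s j))"
    using leading_objects_upward_closed[OF C r J _ m ij(2,3)] by blast
  then show False using Am(2) by blast
qed

lemma lookup_scalar_mult:
  fixes q :: "('e, 'k::comm_ring_1) mpoly"
  shows "Poly_Mapping.lookup (Poly_Mapping.single 0 c * q) n = c * Poly_Mapping.lookup q n"
proof -
  have "Poly_Mapping.single 0 c * q = (\<Sum>m \<in> Poly_Mapping.keys q.
      Poly_Mapping.single m (c * Poly_Mapping.lookup q m))"
    by (subst mpoly_as_sum[of q]) (simp add: sum_distrib_left mult_single)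
  then show ?thesis by (simp add: lookup_sum lookup_single when_def in_keys_iff)
qed

text \<open>Among the elements of \<open>J\<close> outside \<open>I\<close> take one with least leading monomial; subtracting a scalar
  multiple of an element of \<open>I\<close> with the same leading monomial yields a smaller one.  Dividing by
  the leading coefficient is where \<open>k\<close> has to be a field.\<close>

lemma ideal_eq_if_leading_monoms:
  fixes S :: "'e set" and I J :: "('e, 'k::field) mpoly set" and e :: "'e \<Rightarrow> nat"
  assumes e: "inj_on e S"
    and wf: "wf {(m, m'). Poly_Mapping.keys m \<subseteq> S \<and> Poly_Mapping.keys m' \<subseteq> S \<and>
      rename_monom e m < rename_monom e m'}" (is "wf ?R")
    and I: "ideal I (poly_ring S)" and J: "ideal J (poly_ring S)" and sub: "I \<subseteq> J"
    and lead: "\<And>p m. p \<in> J \<Longrightarrow> leading_monom e p m \<Longrightarrow> \<exists>q \<in> I. leading_monom e q m"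
  shows "J = I"
proof (rule ccontr)
  assume "J \<noteq> I"
  then obtain p0 where p0: "p0 \<in> J - I" using sub by blast
  let ?Q = "{m. \<exists>p \<in> J - I. leading_monom e p m}"
  have nonzero: "p \<noteq> 0" if "p \<in> J - I" for p using that poly_ring_ideal_closed(2)[OF I] by blast
  obtain m0 where m0: "m0 \<in> ?Q" using p0 leading_monom_exists[OF nonzero[OF p0]] by blast
  have "\<exists>m \<in> ?Q. \<forall>m'. (m', m) \<in> ?R \<longrightarrow> m' \<notin> ?Q"
    using wf[unfolded wf_eq_minimal, rule_format, OF m0] by simp
  then obtain m where "m \<in> ?Q" and min: "\<And>m'. (m', m) \<in> ?R \<Longrightarrow> m' \<notin> ?Q"
    by blast
  then obtain p where p: "p \<in> J - I" "leading_monom e p m" by blast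
  then obtain q where q: "q \<in> I" "leading_monom e q m" using lead by blast
  let ?lc = "\<lambda>p. Poly_Mapping.lookup p m"
  let ?c = "?lc p / ?lc q"
  define u where "u = p + Poly_Mapping.single 0 (- ?c) * q"
  have lookup_u: "Poly_Mapping.lookup u n = Poly_Mapping.lookup p n - ?c * Poly_Mapping.lookup q n" for n
    by (simp add: u_def lookup_add lookup_scalar_mult)
  have lq: "?lc q \<noteq> 0" using q(2) by (simp add: leading_monom_def in_keys_iff)
  have "u \<in> J"
    unfolding u_def using p(1) q(1) sub poly_ring_ideal_closed(3,4)[OF J] by auto
  moreover have "u \<notin> I"
  proof
    assume "u \<in> I"
    then have "u + Poly_Mapping.single 0 ?c * q \<in> I"
      using q(1) poly_ring_ideal_closed(3,4)[OF I] by auto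
    moreover have "u + Poly_Mapping.single 0 ?c * q = p"
      by (simp add: u_def add.assoc flip: distrib_right single_add)
    ultimately show False using p(1) by simp
  qed
  ultimately have u: "u \<in> J - I" by blast
  obtain m' where m': "leading_monom e u m'" using leading_monom_exists[OF nonzero[OF u]] .
  have m'_in: "m' \<in> Poly_Mapping.keys u" using m' by (simp add: leading_monom_def)
  have "m' \<noteq> m" using m'_in lq by (auto simp: in_keys_iff lookup_u)
  moreover have "rename_monom e m' \<le> rename_monom e m"
  proof -
    have "m' \<in> Poly_Mapping.keys p \<or> m' \<in> Poly_Mapping.keys q"
      using m'_in by (auto simp: in_keys_iff lookup_u)
    then show ?thesis using p(2) q(2) by (auto simp: leading_monom_def)
  qed
  moreover have keys: "Poly_Mapping.keys m \<subseteq> S" "Poly_Mapping.keys m' \<subseteq> S"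
    using poly_ring_ideal_closed(1)[OF J, of p] poly_ring_ideal_closed(1)[OF J, of u] p u m'_in
    by (auto simp: poly_ring_def leading_monom_def)
  ultimately have "(m', m) \<in> ?R"
    using inj_onD[OF inj_on_rename_monom[OF e], of m' m] by (auto simp: less_le)
  then show False using min m' u by blast
qed

lemma G_category_noetherian:
  fixes D :: "('o, 'm, 'e) fi_cat"
  assumes G: "G_category D"
  shows "R_noetherian TYPE('k::field) D"
  unfolding R_noetherian_def
proof (intro allI impI, elim conjE)
  fix J :: "nat \<Rightarrow> 'o \<Rightarrow> ('e, 'k) mpoly set"
  assume "\<forall>n. ideal_system D (J n)" "\<forall>n. \<forall>A \<in> Obj D. J n A \<subseteq> J (Suc n) A"
  then have J: "ideal_system D (J n)" and mono: "A \<in> Obj D \<Longrightarrow> J n A \<subseteq> J (Suc n) A" for n A by auto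
  have C: "fi_concrete D" using G by (simp add: G_category_def)
  obtain r where r: "ordering_on D r" using G by (auto simp: G_category_def orderable_def)
  obtain N where N: "\<And>n. n \<ge> N \<Longrightarrow> leading_objects D r (J n) \<subseteq> leading_objects D r (J N)"
    using leading_objects_stabilise[of D r J, OF G r J mono] by blast
  have "J n A = J N A" if n: "n \<ge> N" and A: "A \<in> Obj D" for n A
  proof (rule ideal_eq_if_leading_monoms)
    show "inj_on (rank (r A)) (pts D A)"
      using inj_on_rank fi_concreteD(2)[OF C A] r A by (auto simp: ordering_on_def)
    show "ideal (J N A) (poly_ring (pts D A))" "ideal (J n A) (poly_ring (pts D A))"
      using J A by (auto simp: ideal_system_def R_obj_def)
    show "J N A \<subseteq> J n A" using lift_Suc_mono_le[of "\<lambda>n. J n A", OF mono[OF A] n] .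
    show "\<exists>q \<in> J N A. leading_monom (rank (r A)) q m"
      if "p \<in> J n A" "leading_monom (rank (r A)) p m" for p m
      using N[OF n] that A by (auto simp: leading_objects_def)
  qed (rule wf_monomial_order[OF G r A])
  then show "\<exists>N. \<forall>n \<ge> N. \<forall>A \<in> Obj D. J n A = J N A" by blast
qed

section \<open>Noetherianity along essentially surjective concrete functors\<close>

lemma FI_isomorphismE:
  assumes "f \<in> homset FI S T" "isomorphism FI f"
  obtains g where "\<And>x. x \<in> S \<Longrightarrow> fst (snd f) x \<in> T" "\<And>y. y \<in> T \<Longrightarrow> g y \<in> S"
    "\<And>y. y \<in> T \<Longrightarrow> fst (snd f) (g y) = y"
proof -
  obtain h where f: "f = (S, h, T)" "h \<in> S \<rightarrow>\<^sub>E T" using assms(1) by (auto simp: FI_def homset_def)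
  obtain g' where "g' \<in> homset FI T S" "Comp FI f g' = Ident FI T"
    using assms by (auto simp: isomorphism_def homset_def)
  then obtain g where g: "g \<in> T \<rightarrow>\<^sub>E S" "compose T h g = (\<lambda>x\<in>T. x)"
    using f by (auto simp: FI_def homset_def)
  have "h (g y) = y" if "y \<in> T" for y using fun_cong[OF g(2), of y] that by (simp add: compose_def)
  then show ?thesis using f g(1) by (intro that[of g]) auto
qed

text \<open>An ideal of the ring of \<open>\<Phi> A\<close> is recovered from its pullback to the ring of \<open>A\<close> because the
  component of \<open>\<eta>\<close> at \<open>A\<close> is a bijection, naturality makes the pullbacks an ideal system, and an isomorphism
  from \<open>\<Phi> A\<close> to \<open>B\<close> identifies the ideals at these two objects.\<close>

lemma noetherian_transfer:
  fixes C :: "('o, 'm, 'e) fi_cat" and D :: "('p, 'n, 'e) fi_cat"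
  assumes D: "fi_concrete D" and C: "fi_concrete C" and \<Phi>: "concrete_functor D C \<Phi> \<eta>"
    and surj: "essentially_surjective D C \<Phi>" and noeth: "R_noetherian TYPE('k::comm_ring_1) D"
  shows "R_noetherian TYPE('k) C"
  unfolding R_noetherian_def
proof (intro allI impI, elim conjE)
  fix J :: "nat \<Rightarrow> 'o \<Rightarrow> ('e, 'k) mpoly set"
  assume "\<forall>n. ideal_system C (J n)" "\<forall>n. \<forall>A \<in> Obj C. J n A \<subseteq> J (Suc n) A"
  then have J: "ideal_system C (J n)" and mono: "A \<in> Obj C \<Longrightarrow> J n A \<subseteq> J (Suc n) A" for n A by auto
  interpret F: cat_functor D C \<Phi> using \<Phi> by (simp add: concrete_functor_def)
  have ideal: "ideal (J n A) (poly_ring (pts C A))" if "A \<in> Obj C" for n A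
    using J that by (auto simp: ideal_system_def R_obj_def)
  have arr: "pushforward (fn C \<phi>) p \<in> J n B" if "\<phi> \<in> homset C A B" "p \<in> J n A" for n \<phi> A B p
  proof -
    have "A \<in> Obj C" "B \<in> Obj C"
      using that(1) F.cod.dom_obj F.cod.cod_obj by (auto simp: homset_def)
    then show ?thesis using J that by (fastforce simp: ideal_system_def R_arr_def)
  qed
  let ?h = "\<lambda>A. fst (snd (\<eta> A))"
  have \<eta>: "\<eta> A \<in> homset FI (pts D A) (pts C (FObj \<Phi> A))" "isomorphism FI (\<eta> A)" if "A \<in> Obj D" for A
    using \<Phi> that by (auto simp: concrete_functor_def natural_isomorphism_def functor_comp_def)
  have h: "?h A x \<in> pts C (FObj \<Phi> A)" if "A \<in> Obj D" "x \<in> pts D A" for A x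
    using FI_isomorphismE[OF \<eta>[OF that(1)]] that(2) by metis
  have natural: "?h B (fn D \<phi> x) = fn C (FArr \<Phi> \<phi>) (?h A x)"
    if \<phi>: "\<phi> \<in> homset D A B" and x: "x \<in> pts D A" for \<phi> A B x
  proof -
    interpret FD: cat_functor D FI "forget D" using D by (simp add: fi_concrete_def)
    interpret FC: cat_functor C FI "forget C" using C by (simp add: fi_concrete_def)
    have obj: "A \<in> Obj D" "B \<in> Obj D" using \<phi> F.dom.dom_obj F.dom.cod_obj by (auto simp: homset_def)
    have "Comp FI (\<eta> B) (FArr (forget D) \<phi>) = Comp FI (FArr (forget C) (FArr \<Phi> \<phi>)) (\<eta> A)"
      using \<Phi> obj \<phi> by (auto simp: concrete_functor_def natural_isomorphism_def functor_comp_def)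
    then have "compose (pts D A) (?h B) (fn D \<phi>) = compose (pts D A) (fn C (FArr \<Phi> \<phi>)) (?h A)"
      using FD.arr_map[OF \<phi>] FC.arr_map[OF F.arr_map[OF \<phi>]] \<eta>(1)[OF obj(1)] \<eta>(1)[OF obj(2)]
      by (auto simp: FI_def homset_def)
    from fun_cong[OF this, of x] show ?thesis using x by (simp add: compose_def)
  qed
  define K where "K n A = {p \<in> carrier (poly_ring (pts D A)). pushforward (?h A) p \<in> J n (FObj \<Phi> A)}"
    for n A
  have K_system: "ideal_system D (K n)" for n
    unfolding ideal_system_def
  proof (intro conjI ballI image_subsetI)
    show "ideal (K n A) (R_obj D A)" if "A \<in> Obj D" for A
      unfolding K_def R_obj_def
      using ideal_pushforward_vimage[OF ideal[OF F.obj_map[OF that]] h[OF that]] .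
    fix A B \<phi> p assume \<phi>: "\<phi> \<in> homset D A B" and p: "p \<in> K n A"
    have pc: "p \<in> carrier (poly_ring (pts D A))" using p by (simp add: K_def)
    have "pushforward (?h B) (pushforward (fn D \<phi>) p) = pushforward (fn C (FArr \<Phi> \<phi>)) (pushforward (?h A) p)"
      unfolding pushforward_comp using natural[OF \<phi>] by (intro pushforward_cong[OF pc]) simp
    moreover have "\<dots> \<in> J n (FObj \<Phi> B)"
      using arr[OF F.arr_map[OF \<phi>]] p by (simp add: K_def)
    moreover have "pushforward (fn D \<phi>) p \<in> carrier (poly_ring (pts D B))"
      using fi_concreteD(3)[OF D \<phi>] by (intro pushforward_carrier[OF pc]) auto
    ultimately show "R_arr D \<phi> p \<in> K n B" by (simp add: K_def R_arr_def)
  qed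
  have K_mono: "K n A \<subseteq> K (Suc n) A" if "A \<in> Obj D" for n A
    using mono[OF F.obj_map[OF that]] by (auto simp: K_def)
  have "\<exists>N. \<forall>n \<ge> N. \<forall>A \<in> Obj D. K n A = K N A"
    by (rule noeth[unfolded R_noetherian_def, THEN spec, THEN mp])
      (intro conjI allI ballI K_system K_mono)
  then obtain N where N: "\<And>n A. n \<ge> N \<Longrightarrow> A \<in> Obj D \<Longrightarrow> K n A = K N A"
    by blast
  have image: "J n (FObj \<Phi> A) \<subseteq> J N (FObj \<Phi> A)" if n: "n \<ge> N" and A: "A \<in> Obj D" for n A
  proof
    fix x assume x: "x \<in> J n (FObj \<Phi> A)"
    obtain g where g: "\<And>y. y \<in> pts C (FObj \<Phi> A) \<Longrightarrow> g y \<in> pts D A"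
      "\<And>y. y \<in> pts C (FObj \<Phi> A) \<Longrightarrow> ?h A (g y) = y" using FI_isomorphismE[OF \<eta>[OF A]] by metis
    have xc: "x \<in> carrier (poly_ring (pts C (FObj \<Phi> A)))"
      using poly_ring_ideal_closed(1)[OF ideal[OF F.obj_map[OF A]] x] .
    have eq: "pushforward (?h A) (pushforward g x) = x"
      unfolding pushforward_comp using g by (intro pushforward_ident[OF xc]) simp
    then have "pushforward g x \<in> K n A" using pushforward_carrier[OF xc g(1)] x by (simp add: K_def)
    then have "pushforward g x \<in> K N A" using N[OF n A] by simp
    then show "x \<in> J N (FObj \<Phi> A)" using eq by (simp add: K_def)
  qed
  have "J n B = J N B" if n: "n \<ge> N" and B: "B \<in> Obj C" for n B
  proof
    show "J N B \<subseteq> J n B" using lift_Suc_mono_le[of "\<lambda>n. J n B", OF mono[OF B] n] .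
    show "J n B \<subseteq> J N B"
    proof
      fix x assume x: "x \<in> J n B"
      have xc: "x \<in> carrier (poly_ring (pts C B))" using poly_ring_ideal_closed(1)[OF ideal[OF B] x] .
      obtain A where A: "A \<in> Obj D" and iso: "(FObj \<Phi> A, B) \<in> isomorphic_rel C"
        using surj B unfolding essentially_surjective_def by blast
      obtain f where f: "f \<in> homset C (FObj \<Phi> A) B" and "isomorphism C f"
        using iso unfolding isomorphic_rel_def by blast
      moreover have "Dom C f = FObj \<Phi> A" "Cod C f = B" using f by (auto simp: homset_def)
      ultimately obtain g where g: "g \<in> homset C B (FObj \<Phi> A)" and fg: "Comp C f g = Ident C B"
        unfolding isomorphism_def by metis
      have inv: "fn C f (fn C g y) = y" if "y \<in> pts C B" for y
      proof -
        have "fn C (Comp C f g) y = y" using fg fi_concreteD(4)[OF C B] that by simp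
        then show ?thesis using fi_concreteD(5)[OF C g f] that by (simp add: compose_def)
      qed
      have "pushforward (fn C g) x \<in> J N (FObj \<Phi> A)" using arr[OF g x] image[OF n A] by blast
      then have "pushforward (fn C f) (pushforward (fn C g) x) \<in> J N B" by (rule arr[OF f])
      moreover have "pushforward (fn C f) (pushforward (fn C g) x) = x"
        unfolding pushforward_comp using inv by (intro pushforward_ident[OF xc]) simp
      ultimately show "x \<in> J N B" by simp
    qed
  qed
  then show "\<exists>N. \<forall>n \<ge> N. \<forall>A \<in> Obj C. J n A = J N A" by blast
qed

theorem theorem2p9:
  fixes C :: "('o, 'm, 'e) fi_cat"
  assumes "QG_category TYPE('p) TYPE('n) C"
  shows "R_noetherian TYPE('k::field) C"
proof -
  obtain D :: "('p, 'n, 'e) fi_cat" and \<Phi> \<eta> where D: "G_category D"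
    and C: "fi_concrete C" "concrete_functor D C \<Phi> \<eta>" "essentially_surjective D C \<Phi>"
    using assms unfolding QG_category_def by blast
  have "fi_concrete D" using D by (simp add: G_category_def)
  then show ?thesis using noetherian_transfer C G_category_noetherian[OF D] by blast
qed

end
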